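(* Let $G$ be a connected $3K_1$-free graph and let $u,v$ be distinct vertices of $G$. Then $G$ has a Hamiltonian path with end-vertices $u$ and $v$ if and only if all of the following hold: (a) neither $u$ nor $v$ is an articulation point of $G$; (b) for every articulation point $x$ of $G$, the vertices $u$ and $v$ belong to different connected components of $G-\{x\}$; (c) $\{u,v\}$ is not a vertex cut of size two in $G$.
   Context: Graphs are finite, simple and undirected. $3K_1$-free means no independent set of size 3. A vertex cut is a set $A\subset V(G)$ such that $G-A$ is disconnected; an articulation point is a vertex $x$ such that $\{x\}$ is a vertex cut. A Hamiltonian path is a path containing all vertices of $G$. *)

theory Defs
  imports "Graph_Theory.Graph_Theory"
begin

text \<open>
  A finite simple undirected graph is rendered by the locale predicate
  \<^const>\<open>graph\<close>: a finite symmetric digraph without loops and parallel arcs,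
  in which each undirected edge is a pair of opposite arcs.
\<close>

abbreviation delete_verts :: "('a, 'b) pre_digraph \<Rightarrow> 'a set \<Rightarrow> ('a, 'b) pre_digraph" where
  "delete_verts G A \<equiv> G \<restriction> (verts G - A)"

definition independent_set :: "('a, 'b) pre_digraph \<Rightarrow> 'a set \<Rightarrow> bool" where
  "independent_set G S \<longleftrightarrow> S \<subseteq> verts G \<and> (\<forall>x\<in>S. \<forall>y\<in>S. \<not> x \<rightarrow>\<^bsub>G\<^esub> y)"

definition three_K1_free :: "('a, 'b) pre_digraph \<Rightarrow> bool" where
  "three_K1_free G \<longleftrightarrow> \<not> (\<exists>S. independent_set G S \<and> card S = 3)"

text \<open>
  The inclusion is proper because \<^const>\<open>connected\<close> is false for the null graph:
  deleting all vertices must not count as disconnecting the graph.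
\<close>
definition vertex_cut :: "('a, 'b) pre_digraph \<Rightarrow> 'a set \<Rightarrow> bool" where
  "vertex_cut G A \<longleftrightarrow> A \<subset> verts G \<and> \<not> connected (delete_verts G A)"

definition articulation_point :: "('a, 'b) pre_digraph \<Rightarrow> 'a \<Rightarrow> bool" where
  "articulation_point G x \<longleftrightarrow> vertex_cut G {x}"

definition connected_components :: "('a, 'b) pre_digraph \<Rightarrow> ('a, 'b) pre_digraph set" where
  "connected_components G = {C. pre_digraph.max_subgraph G connected C}"

definition in_different_components :: "('a, 'b) pre_digraph \<Rightarrow> 'a \<Rightarrow> 'a \<Rightarrow> bool" where
  "in_different_components G u v \<longleftrightarrow>
     (\<exists>C\<in>connected_components G. \<exists>D\<in>connected_components G.
        C \<noteq> D \<and> u \<in> verts C \<and> v \<in> verts D)"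

definition hamiltonian_path :: "('a, 'b) pre_digraph \<Rightarrow> 'a list \<Rightarrow> bool" where
  "hamiltonian_path G p \<longleftrightarrow> vpath p G \<and> set p = verts G"

end

theory Submission
  imports Defs
begin

text \<open>
  If \<open>G\<close> has a Hamiltonian path between \<open>u\<close> and \<open>v\<close>, then deleting \<open>u\<close>, \<open>v\<close> or both leaves a
  path, and deleting an inner vertex \<open>x\<close> leaves two paths, so that \<open>G - x\<close> is connected unless it
  separates their end-vertices \<open>u\<close> and \<open>v\<close>.

  Conversely, let \<open>p\<close> be a longest path from \<open>u\<close> to \<open>v\<close> and suppose that it misses a vertex \<open>w\<close>.
  Let \<open>N\<close> be the set of neighbours on \<open>p\<close> of the component of \<open>w\<close> in \<open>G - p\<close>. By the rerouting
  argument of Chvatal and Erdos, the successors on \<open>p\<close> of two members of \<open>N\<close> would form together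
  with \<open>w\<close> an independent set of size 3. Hence at most one member of \<open>N\<close> has a successor, and by
  symmetry at most one has a predecessor, so that either \<open>N = {u, v}\<close> or \<open>N\<close> has at most one
  element. In the first case \<open>{u, v}\<close> is a vertex cut, in the second the element of \<open>N\<close> is an
  articulation point \<open>x\<close>; if \<open>x\<close> is neither \<open>u\<close> nor \<open>v\<close>, then \<open>u\<close>, \<open>v\<close> and \<open>w\<close> lie in three
  different components of \<open>G - x\<close> and form an independent set.
\<close>

section \<open>Reachability, connectedness and components in symmetric digraphs\<close>

lemma dominates_induce_iff:
  "a \<rightarrow>\<^bsub>G \<restriction> S\<^esub> b \<longleftrightarrow> a \<rightarrow>\<^bsub>G\<^esub> b \<and> a \<in> S \<and> b \<in> S"
  by (auto simp: arcs_ends_conv)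

lemma reachable_closed:
  assumes "a \<rightarrow>\<^sup>*\<^bsub>H\<^esub> b" "a \<in> T" "\<And>x y. x \<in> T \<Longrightarrow> x \<rightarrow>\<^bsub>H\<^esub> y \<Longrightarrow> y \<in> T"
  shows "b \<in> T"
  using assms(1) unfolding reachable_def
  by (induct rule: rtrancl_on_induct) (auto intro: assms(2,3))

lemma (in sym_digraph) sym_digraph_induce: "S \<subseteq> verts G \<Longrightarrow> sym_digraph (G \<restriction> S)"
  by (intro induced_graph_imp_graph induced_induce)

text \<open>\<open>connected\<close> is strong connectedness of the symmetric closure, and closing
  symmetric arcs leaves reachability unchanged.\<close>

lemma (in sym_digraph) connected_iff_strongly_connected:
  "connected G \<longleftrightarrow> strongly_connected G"
  by (simp add: connected_def strongly_connected_def reachable_mk_symmetric_eq[OF sym_arcs])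

lemma (in sym_digraph) connected_subgraph_reachable:
  assumes "subgraph H G" "connected H" "a \<in> verts H" "b \<in> verts H"
  shows "a \<rightarrow>\<^sup>* b"
proof -
  have "a \<rightarrow>\<^sup>*\<^bsub>mk_symmetric H\<^esub> b"
    using assms by (auto simp: connected_def strongly_connected_def)
  then have "a \<rightarrow>\<^sup>*\<^bsub>mk_symmetric G\<^esub> b"
    using subgraph_mk_symmetric[OF assms(1)] by (rule pre_digraph.reachable_mono)
  then show ?thesis by (simp add: reachable_mk_symmetric_eq[OF sym_arcs])
qed

text \<open>Every connected subgraph containing \<open>u\<close> has only vertices reachable from
  \<open>u\<close>, so the graph induced by these is the greatest such subgraph and the only maximal
  one.\<close>

lemma (in sym_digraph) connected_component_of:
  assumes "u \<in> verts G"
  shows "C \<in> connected_components G \<and> u \<in> verts C \<longleftrightarrow> C = G \<restriction> {w. u \<rightarrow>\<^sup>* w}"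
proof -
  let ?C = "G \<restriction> {w. u \<rightarrow>\<^sup>* w}"
  have scc: "?C \<in> sccs" using assms by (rule induce_reachable_is_in_sccs)
  then have ind: "induced_subgraph ?C G" and "strongly_connected ?C" by (auto simp: sccs_def)
  then have conn: "connected ?C"
    using sym_digraph.connected_iff_strongly_connected[OF induced_graph_imp_graph[OF ind]] by simp
  have sub: "subgraph H ?C" if "subgraph H G" "connected H" "u \<in> verts H" for H
  proof -
    have "verts H \<subseteq> {w. u \<rightarrow>\<^sup>* w}"
      using connected_subgraph_reachable[OF that(1,2,3)] by auto
    moreover have "subgraph H (G \<restriction> verts H)"
      using that(1) by (rule subgraph_induce_subgraphI2)
    ultimately show ?thesis
      using wellformed_induce_subgraph[of "{w. u \<rightarrow>\<^sup>* w}"]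
      by (auto simp: subgraph_def compatible_def)
  qed
  have subC: "subgraph ?C G" using ind by (rule induced_imp_subgraph)
  \<comment> \<open>\<open>compatible\<close> makes \<open>tail\<close> and \<open>head\<close>
    agree, so mutual inclusion is equality of records.\<close>
  have anti: "H = ?C" if "subgraph ?C H" "subgraph H ?C" for H
    using that by (intro pre_digraph.equality) (auto simp: subgraph_def compatible_def)
  have uC: "u \<in> verts ?C" using assms by simp
  have "max_subgraph connected ?C"
    unfolding max_subgraph_def
  proof (intro conjI allI impI notI)
    fix H assume H: "H \<noteq> ?C \<and> subgraph ?C H" "subgraph H G \<and> connected H"
    then have "u \<in> verts H" using uC subgraph_imp_subverts[of ?C H] by blast
    with H show False using sub[of H] anti[of H] by blast
  qed (rule subC, rule conn)
  moreover have "C = ?C" if C: "max_subgraph connected C" "u \<in> verts C"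
  proof -
    have "subgraph C ?C" using C sub[of C] by (simp add: max_subgraph_def)
    then show ?thesis using C(1) conn subC unfolding max_subgraph_def by metis
  qed
  ultimately show ?thesis using uC unfolding connected_components_def by blast
qed

text \<open>Each vertex lies in exactly one component, the one induced by what it reaches.\<close>

lemma (in sym_digraph) in_different_components_iff:
  assumes "u \<in> verts G" "v \<in> verts G"
  shows "in_different_components G u v \<longleftrightarrow> \<not> u \<rightarrow>\<^sup>* v"
proof -
  have "in_different_components G u v \<longleftrightarrow>
      G \<restriction> {w. u \<rightarrow>\<^sup>* w} \<noteq> G \<restriction> {w. v \<rightarrow>\<^sup>* w}"
    unfolding in_different_components_def
    using connected_component_of[OF assms(1)] connected_component_of[OF assms(2)] by metis
  also have "\<dots> \<longleftrightarrow> {w. u \<rightarrow>\<^sup>* w} \<noteq> {w. v \<rightarrow>\<^sup>* w}"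
    by (metis induce_subgraph_verts)
  also have "\<dots> \<longleftrightarrow> \<not> u \<rightarrow>\<^sup>* v"
  proof
    assume "{w. u \<rightarrow>\<^sup>* w} \<noteq> {w. v \<rightarrow>\<^sup>* w}"
    then show "\<not> u \<rightarrow>\<^sup>* v" using symmetric_reachable' reachable_trans by blast
  next
    assume "\<not> u \<rightarrow>\<^sup>* v"
    then show "{w. u \<rightarrow>\<^sup>* w} \<noteq> {w. v \<rightarrow>\<^sup>* w}" using reachable_refl[OF assms(2)] by blast
  qed
  finally show ?thesis .
qed

section \<open>Paths as lists of vertices\<close>

text \<open>Expressing walks by \<open>successively\<close> gives access to its append and reversal
  rules, by which paths are split and spliced below.\<close>

lemma vpath_iff_successively:
  "vpath p G \<longleftrightarrow> p \<noteq> [] \<and> distinct p \<and> set p \<subseteq> verts G \<and> successively (dominates G) p"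
proof -
  have "set (vwalk_arcs p) \<subseteq> arcs_ends G \<longleftrightarrow> successively (dominates G) p"
    by (induct p rule: vwalk_arcs.induct) auto
  then show ?thesis by (auto simp: vpath_def vwalk_def)
qed

lemma (in sym_digraph) successively_rev_iff:
  "successively (dominates G) (rev p) \<longleftrightarrow> successively (dominates G) p"
proof -
  have "(\<lambda>x y. y \<rightarrow> x) = dominates G" using graph_symmetric by blast
  then show ?thesis by (simp only: successively_rev)
qed

lemma (in sym_digraph) vpath_rev_iff: "vpath (rev p) G \<longleftrightarrow> vpath p G"
  by (simp add: vpath_iff_successively successively_rev_iff del: successively_rev)

lemma successively_induce:
  assumes "successively (dominates G) p" "set p \<subseteq> S"
  shows "successively (dominates (G \<restriction> S)) p"
  using assms by (induct p rule: induct_list012) (auto simp: dominates_induce_iff)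

lemma (in sym_digraph) successively_reachable:
  assumes "successively (dominates G) p" "set p \<subseteq> verts G" "a \<in> set p" "b \<in> set p"
  shows "a \<rightarrow>\<^sup>* b"
proof -
  have "hd p \<rightarrow>\<^sup>* c" if "c \<in> set p" for c
    using assms(1,2) that
  proof (induct p rule: induct_list012)
    case (3 x y zs)
    then show ?case
      by (cases "c = x") (auto intro: adj_reachable_trans)
  qed auto
  then show ?thesis
    using assms(3,4) symmetric_reachable' reachable_trans by blast
qed

lemma (in wf_digraph) reachable_imp_vpath:
  assumes "a \<rightarrow>\<^sup>* b"
  obtains p where "vpath p G" "hd p = a" "last p = b"
proof -
  from assms have "\<exists>p. vwalk p G \<and> hd p = a \<and> last p = b"
  proof (induct rule: converse_reachable_induct)
    case base
    then show ?case by (intro exI[of _ "[b]"]) (auto simp: vwalk_def)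
  next
    case (step x y)
    then obtain p where p: "vwalk p G" "hd p = y" "last p = b" by blast
    with step have "vwalk (x # p) G" by (auto intro: vwalk_wf_digraph_consI)
    with p show ?case by (intro exI[of _ "x # p"]) (auto simp: vwalk_def)
  qed
  then show ?thesis using that vwalk_imp_ex_vpath by metis
qed

section \<open>Necessity: deleting vertices of a Hamiltonian path\<close>

lemma (in sym_digraph) connected_induceI:
  assumes "successively (dominates G) q" "q \<noteq> []" "set q \<subseteq> verts G"
  shows "connected (G \<restriction> set q)"
proof -
  interpret Q: sym_digraph "G \<restriction> set q" using assms(3) by (rule sym_digraph_induce)
  show ?thesis
    unfolding Q.connected_iff_strongly_connected
    using assms Q.successively_reachable[OF successively_induce]
    by (auto intro!: strongly_connectedI)
qed

lemma (in sym_digraph) hamiltonian_path_imp: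
  assumes ham: "hamiltonian_path G p" "hd p = u" "last p = v" and neq: "u \<noteq> v"
  shows "\<not> articulation_point G u" "\<not> articulation_point G v"
    "\<And>x. articulation_point G x \<Longrightarrow> in_different_components (delete_verts G {x}) u v"
    "\<not> vertex_cut G {u, v}"
proof -
  from ham have p: "p \<noteq> []" "distinct p" "set p = verts G" "successively (dominates G) p"
    by (auto simp: hamiltonian_path_def vpath_iff_successively)
  obtain m where m: "p = u # m @ [v]"
    using p(1) ham(2,3) neq
    by (metis append_butlast_last_id hd_Cons_tl last.simps)
  \<comment> \<open>What survives is the contiguous stretch \<open>q\<close>, again a path. If
    \<open>q\<close> is empty, \<open>A\<close> is not a proper subset of the vertices.\<close>
  have no_cut: "\<not> vertex_cut G A"
    if "p = xs @ q @ ys" "A = set xs \<union> set ys" for A xs q ys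
  proof (cases "q = []")
    case False
    have "successively (dominates G) q"
      using p(4) that(1) by (simp add: successively_append_iff)
    moreover have "set q = verts G - A" using p(2,3) that by auto
    ultimately show ?thesis
      using connected_induceI[of q] False by (auto simp: vertex_cut_def)
  qed (use that p(3) in \<open>auto simp: vertex_cut_def\<close>)
  show u: "\<not> articulation_point G u"
    using no_cut[of "[u]" "m @ [v]" "[]"] m by (simp add: articulation_point_def)
  show v: "\<not> articulation_point G v"
    using no_cut[of "[]" "u # m" "[v]"] m by (simp add: articulation_point_def)
  show "\<not> vertex_cut G {u, v}"
    using no_cut[of "[u]" m "[v]"] m by (simp add: insert_commute)
  fix x assume x: "articulation_point G x"
  then have xV: "x \<in> verts G" and nc: "\<not> connected (delete_verts G {x})"
    by (auto simp: articulation_point_def vertex_cut_def)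
  interpret D: sym_digraph "delete_verts G {x}" by (rule sym_digraph_induce) blast
  from x u v have "x \<noteq> u" "x \<noteq> v" by auto
  with xV p(3) m have "x \<in> set m" by auto
  then obtain q r where "m = q @ x # r" by (meson split_list)
  then have p_eq: "p = (u # q) @ x # (r @ [v])" using m by simp
  have V: "verts G - {x} = set (u # q) \<union> set (r @ [v])"
    using p(2,3) p_eq by auto
  have sub: "set (u # q) \<subseteq> verts G - {x}" "set (r @ [v]) \<subseteq> verts G - {x}"
    unfolding V by blast+
  have "successively (dominates G) (u # q)" "successively (dominates G) (r @ [v])"
    using p(4) unfolding p_eq
    by (auto simp: successively_append_iff successively_Cons hd_append split: if_splits)
  note walks = successively_induce[OF this(1) sub(1)] successively_induce[OF this(2) sub(2)]
  have "\<not> u \<rightarrow>\<^sup>*\<^bsub>delete_verts G {x}\<^esub> v"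
  proof
    \<comment> \<open>\<open>u\<close> reaches the stretch before \<open>x\<close> and, through
      \<open>v\<close>, the stretch behind it, so \<open>G - x\<close> would be connected.\<close>
    assume uv: "u \<rightarrow>\<^sup>*\<^bsub>delete_verts G {x}\<^esub> v"
    have "u \<rightarrow>\<^sup>*\<^bsub>delete_verts G {x}\<^esub> a" if "a \<in> verts G - {x}" for a
    proof (cases "a \<in> set (u # q)")
      case True
      then show ?thesis
        by (intro D.successively_reachable[OF walks(1)]) (use sub(1) in simp_all)
    next
      case False
      then have "v \<rightarrow>\<^sup>*\<^bsub>delete_verts G {x}\<^esub> a"
        by (intro D.successively_reachable[OF walks(2)]) (use sub(2) V that in auto)
      with uv show ?thesis by (rule D.reachable_trans)
    qed
    then have "a \<rightarrow>\<^sup>*\<^bsub>delete_verts G {x}\<^esub> b"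
      if "a \<in> verts G - {x}" "b \<in> verts G - {x}" for a b
      using that D.symmetric_reachable' D.reachable_trans by blast
    then have "strongly_connected (delete_verts G {x})"
      using sub(1) by (intro strongly_connectedI) auto
    then show False using nc D.connected_iff_strongly_connected by blast
  qed
  then show "in_different_components (delete_verts G {x}) u v"
    using sub by (subst D.in_different_components_iff) auto
qed

section \<open>Longest paths between two fixed ends\<close>

definition longest_path :: "('a, 'b) pre_digraph \<Rightarrow> 'a \<Rightarrow> 'a \<Rightarrow> 'a list \<Rightarrow> bool" where
  "longest_path G u v p \<longleftrightarrow> vpath p G \<and> hd p = u \<and> last p = v \<and>
     (\<forall>q. vpath q G \<and> hd q = u \<and> last q = v \<longrightarrow> length q \<le> length p)"

lemma (in fin_digraph) longest_path_exists:
  assumes "u \<rightarrow>\<^sup>* v"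
  obtains p where "longest_path G u v p"
proof -
  let ?P = "\<lambda>q. vpath q G \<and> hd q = u \<and> last q = v"
  obtain q where q: "?P q" using assms by (rule reachable_imp_vpath) blast
  have "length r < Suc (card (verts G))" if "?P r" for r
    using that card_mono[OF finite_verts, of "set r"]
    by (auto simp: vpath_iff_successively distinct_card)
  then have "\<exists>p. ?P p \<and> (\<forall>r. ?P r \<longrightarrow> length r \<le> length p)"
    using q by (intro ex_has_greatest_nat) auto
  then show ?thesis using that unfolding longest_path_def by blast
qed

text \<open>Turns statements about successors on the path into statements about
  predecessors.\<close>

lemma (in sym_digraph) longest_path_rev:
  assumes "longest_path G u v p"
  shows "longest_path G v u (rev p)"
proof -
  have "length q \<le> length p" if "vpath q G" "hd q = v" "last q = u" for q
  proof -
    have "q \<noteq> []" using that(1) by (simp add: vpath_iff_successively)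
    then have "vpath (rev q) G" "hd (rev q) = u" "last (rev q) = v"
      using that by (simp_all add: vpath_rev_iff hd_rev last_rev)
    then have "length (rev q) \<le> length p" using assms unfolding longest_path_def by blast
    then show ?thesis by simp
  qed
  moreover have "p \<noteq> []" using assms by (simp add: longest_path_def vpath_iff_successively)
  ultimately show ?thesis
    using assms by (auto simp: longest_path_def vpath_rev_iff hd_rev last_rev)
qed

section \<open>Rerouting through the component of a missed vertex\<close>

definition off_component :: "('a, 'b) pre_digraph \<Rightarrow> 'a list \<Rightarrow> 'a \<Rightarrow> 'a set" where
  "off_component G p w = {h. w \<rightarrow>\<^sup>*\<^bsub>delete_verts G (set p)\<^esub> h}"

text \<open>The set \<open>N\<close> of the overview.\<close>

definition attachments :: "('a, 'b) pre_digraph \<Rightarrow> 'a list \<Rightarrow> 'a \<Rightarrow> 'a set" where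
  "attachments G p w = {x \<in> set p. \<exists>h\<in>off_component G p w. x \<rightarrow>\<^bsub>G\<^esub> h}"

lemma off_component_rev: "off_component G (rev p) w = off_component G p w"
  by (simp add: off_component_def)

lemma attachments_rev: "attachments G (rev p) w = attachments G p w"
  by (simp add: attachments_def off_component_rev)

text \<open>Both vertices have neighbours in the component of \<open>w\<close>, and a path inside it
  joins these. That \<open>q\<close> is nonempty makes rerouted paths strictly longer.\<close>

lemma (in sym_digraph) detour:
  assumes "x \<in> attachments G p w" "y \<in> attachments G p w"
  obtains q where "q \<noteq> []" "distinct q" "set q \<subseteq> verts G" "set q \<inter> set p = {}"
    "successively (dominates G) q" "x \<rightarrow> hd q" "last q \<rightarrow> y"
proof -
  interpret D: sym_digraph "delete_verts G (set p)" by (rule sym_digraph_induce) blast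
  obtain h k where hk: "h \<in> off_component G p w" "x \<rightarrow> h" "k \<in> off_component G p w" "y \<rightarrow> k"
    using assms by (auto simp: attachments_def)
  then have "h \<rightarrow>\<^sup>*\<^bsub>delete_verts G (set p)\<^esub> k"
    unfolding off_component_def using D.symmetric_reachable' D.reachable_trans by blast
  then obtain q where q: "vpath q (delete_verts G (set p))" "hd q = h" "last q = k"
    by (rule D.reachable_imp_vpath)
  have "successively (dominates G) q"
    using q(1) unfolding vpath_iff_successively
    by (auto simp: dominates_induce_iff elim: successively_mono)
  then show ?thesis
    using that[of q] q hk(2) graph_symmetric[OF hk(4)] by (auto simp: vpath_iff_successively)
qed

text \<open>Otherwise a detour could be inserted between \<open>x\<close> and
  \<open>y\<close>.\<close>

lemma (in sym_digraph) longest_path_consecutive: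
  assumes "longest_path G u v (as @ x # y # bs)"
    "x \<in> attachments G (as @ x # y # bs) w"
  shows "y \<notin> attachments G (as @ x # y # bs) w"
proof
  let ?p = "as @ x # y # bs"
  assume "y \<in> attachments G ?p w"
  with assms(2) obtain q where q: "q \<noteq> []" "distinct q" "set q \<subseteq> verts G" "set q \<inter> set ?p = {}"
    "successively (dominates G) q" "x \<rightarrow> hd q" "last q \<rightarrow> y" by (rule detour)
  let ?r = "as @ x # q @ y # bs"
  have "vpath ?p G" "hd ?p = u" "last ?p = v"
    using assms(1) by (simp_all add: longest_path_def)
  then have "vpath ?r G" "hd ?r = u" "last ?r = v"
    using q by (auto simp: vpath_iff_successively successively_append_iff successively_Cons hd_append)
  then have "length ?r \<le> length ?p" using assms(1) unfolding longest_path_def by blast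
  then show False using q(1) by simp
qed

text \<open>Chvatal and Erdos: otherwise the path could run through the detour from \<open>x\<close> to \<open>x'\<close>,
  then backwards from \<open>x'\<close> to \<open>y\<close>, and on from \<open>y'\<close>.\<close>
lemma (in sym_digraph) longest_path_successors:
  assumes "longest_path G u v (as @ x # y # bs @ x' # y' # cs)"
    "x \<in> attachments G (as @ x # y # bs @ x' # y' # cs) w"
    "x' \<in> attachments G (as @ x # y # bs @ x' # y' # cs) w"
  shows "\<not> y \<rightarrow> y'"
proof
  let ?p = "as @ x # y # bs @ x' # y' # cs"
  assume yy: "y \<rightarrow> y'"
  from assms(2,3) obtain q where q: "q \<noteq> []" "distinct q" "set q \<subseteq> verts G" "set q \<inter> set ?p = {}"
    "successively (dominates G) q" "x \<rightarrow> hd q" "last q \<rightarrow> x'" by (rule detour)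
  let ?m = "rev (y # bs @ [x'])"
  let ?r = "as @ x # q @ ?m @ y' # cs"
  have p: "vpath ?p G" "hd ?p = u" "last ?p = v"
    using assms(1) by (simp_all add: longest_path_def)
  have "successively (dominates G) (y # bs @ [x'])"
    using p(1) unfolding vpath_iff_successively
    by (auto simp: successively_append_iff successively_Cons hd_append split: if_splits)
  then have "successively (dominates G) ?m" by (simp only: successively_rev_iff)
  then have "vpath ?r G" "hd ?r = u" "last ?r = v"
    using p q yy by (auto simp: vpath_iff_successively successively_append_iff successively_Cons hd_append)
  then have "length ?r \<le> length ?p" using assms(1) unfolding longest_path_def by blast
  then show False using q(1) by simp
qed

section \<open>Independent triples bound the number of attachments\<close>

text \<open>Three pairs suffice: symmetry covers the reversed pairs and the absence of loops the
  equal ones.\<close>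

lemma three_K1_free_triple:
  assumes "three_K1_free G" "loopfree_digraph G" "sym_digraph G"
    and "{a, b, c} \<subseteq> verts G" "a \<noteq> b" "a \<noteq> c" "b \<noteq> c"
  shows "a \<rightarrow>\<^bsub>G\<^esub> b \<or> a \<rightarrow>\<^bsub>G\<^esub> c \<or> b \<rightarrow>\<^bsub>G\<^esub> c"
proof (rule ccontr)
  interpret loopfree_digraph G by fact
  interpret sym_digraph G by fact
  assume "\<not> ?thesis"
  then have "independent_set G {a, b, c}"
    using assms(4) graph_symmetric adj_not_same unfolding independent_set_def by blast
  moreover have "card {a, b, c} = 3" using assms(5-7) by simp
  ultimately show False using assms(1) unfolding three_K1_free_def by blast
qed

lemma split_list_two:
  assumes "x \<in> set p" "y \<in> set p" "x \<noteq> y"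
  obtains as bs cs where "p = as @ x # bs @ y # cs" | as bs cs where "p = as @ y # bs @ x # cs"
proof -
  obtain as bs where p: "p = as @ x # bs" using assms(1) by (meson split_list)
  with assms(2,3) consider "y \<in> set as" | "y \<in> set bs" by auto
  then show ?thesis
  proof cases
    case 1
    then obtain cs ds where "as = cs @ y # ds" by (meson split_list)
    with p that(2)[of cs ds bs] show ?thesis by simp
  next
    case 2
    then obtain cs ds where "bs = cs @ y # ds" by (meson split_list)
    with p that(1)[of as cs ds] show ?thesis by simp
  qed
qed

lemma (in graph) attachments_off_end:
  assumes free: "three_K1_free G" and lp: "longest_path G u v p"
    and w: "w \<in> verts G - set p"
    and "x \<in> attachments G p w" "x' \<in> attachments G p w" "x \<noteq> v" "x' \<noteq> v"
  shows "x = x'"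
proof (rule ccontr)
  \<comment> \<open>Here \<open>x\<close> precedes \<open>x'\<close> on \<open>p\<close>; their
    successors \<open>y\<close> and \<open>y'\<close> and the missed vertex \<open>w\<close> will be
    independent.\<close>
  have no_ordered: False if x: "x \<in> attachments G p w" "x' \<in> attachments G p w" "x' \<noteq> v"
    and p: "p = as @ x # bs @ x' # cs" for x x' as bs cs
  proof -
    have "cs \<noteq> []" using lp x(3) p by (auto simp: longest_path_def)
    then obtain y' cs' where cs: "cs = y' # cs'" by (cases cs) auto
    \<comment> \<open>Consecutive attachments are impossible, so the successor \<open>y\<close> of
      \<open>x\<close> is not \<open>x'\<close>.\<close>
    have "bs \<noteq> []" using longest_path_consecutive[of u v as x x' cs w] lp x p by auto
    then obtain y bs' where bs: "bs = y # bs'" by (cases bs) auto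
    have p: "p = as @ x # y # bs' @ x' # y' # cs'" using p bs cs by simp
    then have p': "p = (as @ x # y # bs') @ x' # y' # cs'" by simp
    have ny: "y \<notin> attachments G p w"
      using longest_path_consecutive[of u v as x y "bs' @ x' # y' # cs'" w] lp x(1) p by simp
    have ny': "y' \<notin> attachments G p w"
      using longest_path_consecutive[of u v "as @ x # y # bs'" x' y' cs' w] lp x(2) p by simp
    have "\<not> y \<rightarrow> y'"
      using longest_path_successors[of u v as x y bs' x' y' cs' w] lp x p by simp
    \<comment> \<open>As \<open>w\<close> lies in its own component, its neighbours on
      \<open>p\<close> are attachments, which \<open>y\<close> and \<open>y'\<close> are
      not.\<close>
    moreover have "w \<in> off_component G p w" using w
      by (auto simp: off_component_def reachable_def)
    then have "\<not> y \<rightarrow> w" "\<not> y' \<rightarrow> w" using ny ny' p by (auto simp: attachments_def)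
    moreover have "distinct p" "set p \<subseteq> verts G"
      using lp by (auto simp: longest_path_def vpath_iff_successively)
    ultimately show False
      using three_K1_free_triple[of G y y' w] free w p loopfree_digraph_axioms sym_digraph_axioms
      by auto
  qed
  assume "x \<noteq> x'"
  moreover have "x \<in> set p" "x' \<in> set p" using assms(4,5) by (auto simp: attachments_def)
  ultimately show False using no_ordered assms(4-7) by (metis split_list_two)
qed

section \<open>Sufficiency: cuts formed by the attachments\<close>

text \<open>An edge from the component of \<open>w\<close> either stays in it or ends in an
  attachment, which lies in \<open>A\<close>. So the component is closed under the edges of
  \<open>G - A\<close>, and it misses \<open>p\<close>.\<close>

lemma (in sym_digraph) off_component_separated:
  assumes "attachments G p w \<subseteq> A" "w \<in> verts G - set p" "z \<in> set p"
  shows "\<not> w \<rightarrow>\<^sup>*\<^bsub>delete_verts G A\<^esub> z"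
proof
  interpret D: sym_digraph "delete_verts G (set p)" by (rule sym_digraph_induce) blast
  have sub: "off_component G p w \<subseteq> verts G - set p"
    by (auto simp: off_component_def dest: D.reachable_in_verts)
  assume "w \<rightarrow>\<^sup>*\<^bsub>delete_verts G A\<^esub> z"
  then have "z \<in> off_component G p w"
  proof (rule reachable_closed)
    show "w \<in> off_component G p w"
      using assms(2) by (simp add: off_component_def)
    fix a b assume a: "a \<in> off_component G p w" and "a \<rightarrow>\<^bsub>delete_verts G A\<^esub> b"
    then have ab: "a \<rightarrow> b" "b \<in> verts G" "b \<notin> A" by (auto simp: dominates_induce_iff)
    with assms(1) a have "b \<notin> set p"
      using graph_symmetric by (auto simp: attachments_def)
    then have "a \<rightarrow>\<^bsub>delete_verts G (set p)\<^esub> b"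
      using ab a sub by (auto simp: dominates_induce_iff)
    then show "b \<in> off_component G p w"
      using a unfolding off_component_def using D.reachable_adj_trans by blast
  qed
  then show False using sub assms(3) by blast
qed

lemma (in sym_digraph) vertex_cutI:
  assumes "A \<subseteq> verts G" "a \<in> verts G - A" "b \<in> verts G - A" "\<not> a \<rightarrow>\<^sup>*\<^bsub>delete_verts G A\<^esub> b"
  shows "vertex_cut G A"
proof -
  interpret D: sym_digraph "delete_verts G A" by (rule sym_digraph_induce) blast
  have "\<not> connected (delete_verts G A)"
    using assms(2-4) by (auto simp: D.connected_iff_strongly_connected strongly_connected_def)
  then show ?thesis using assms(1,2) by (auto simp: vertex_cut_def)
qed

lemma (in graph) longest_path_hamiltonian:
  assumes conn: "connected G" and free: "three_K1_free G" and neq: "u \<noteq> v"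
    and lp: "longest_path G u v p"
    and art: "\<not> articulation_point G u" "\<not> articulation_point G v"
      "\<And>x. articulation_point G x \<Longrightarrow> in_different_components (delete_verts G {x}) u v"
    and cut: "\<not> vertex_cut G {u, v}"
  shows "hamiltonian_path G p"
proof -
  have p: "vpath p G" "hd p = u" "last p = v" "p \<noteq> []" "set p \<subseteq> verts G"
    using lp by (auto simp: longest_path_def vpath_iff_successively)
  have uv: "u \<in> set p" "v \<in> set p" using p by auto
  have "w \<in> set p" if "w \<in> verts G" for w
  proof (rule ccontr)
    assume "w \<notin> set p"
    with that have w: "w \<in> verts G - set p" by blast
    let ?N = "attachments G p w"
    have N: "?N \<subseteq> set p" by (auto simp: attachments_def)
    have sep: "vertex_cut G A" if "?N \<subseteq> A" "A \<subseteq> set p" "z \<in> set p - A" for A z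
      using off_component_separated[OF that(1) w, of z] that w p(5) by (intro vertex_cutI[of A w z]) auto
    \<comment> \<open>At least one of \<open>u\<close> and \<open>v\<close> differs from
      \<open>x\<close> and is a path vertex that survives the deletion.\<close>
    have art_sep: "articulation_point G x" if "?N \<subseteq> {x}" "x \<in> set p" for x
      using sep[of "{x}" u] sep[of "{x}" v] that uv neq by (auto simp: articulation_point_def)
    \<comment> \<open>If \<open>?N\<close> were empty, it would lie in \<open>{u}\<close>, making
      \<open>u\<close> an articulation point.\<close>
    have "?N \<noteq> {}" using art_sep[of u] art(1) uv by auto
    then obtain x where x: "x \<in> ?N" by blast
    show False
    proof (cases "?N = {x}")
      case True
      have xp: "x \<in> set p" using x N by blast
      then have ap: "articulation_point G x" using True by (intro art_sep) auto
      then have "x \<noteq> u" "x \<noteq> v" using art by auto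
      interpret D: sym_digraph "delete_verts G {x}" by (rule sym_digraph_induce) blast
      have V: "u \<in> verts G - {x}" "v \<in> verts G - {x}" "w \<in> verts G - {x}"
        using uv p(5) \<open>x \<noteq> u\<close> \<open>x \<noteq> v\<close> w xp by auto
      have "\<not> u \<rightarrow>\<^sup>*\<^bsub>delete_verts G {x}\<^esub> v"
        using art(3)[OF ap] V by (simp add: D.in_different_components_iff)
      moreover have "\<not> w \<rightarrow>\<^sup>*\<^bsub>delete_verts G {x}\<^esub> u" "\<not> w \<rightarrow>\<^sup>*\<^bsub>delete_verts G {x}\<^esub> v"
        using off_component_separated[of p w "{x}"] True w uv by auto
      \<comment> \<open>Adjacent vertices of \<open>G - x\<close> reach each other, so
        \<open>u\<close>, \<open>v\<close> and \<open>w\<close> are pairwise nonadjacent.\<close>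
      ultimately have "\<not> u \<rightarrow> v" "\<not> w \<rightarrow> u" "\<not> w \<rightarrow> v"
        using V D.reachable_adjI by (auto simp: dominates_induce_iff)
      then show False
        using three_K1_free_triple[of G w u v] free V neq uv w loopfree_digraph_axioms
          sym_digraph_axioms by auto
    next
      case False
      then obtain y where y: "y \<in> ?N" "y \<noteq> x" using x by blast
      have off_v: "a = b" if "a \<in> ?N" "b \<in> ?N" "a \<noteq> v" "b \<noteq> v" for a b
        using attachments_off_end[OF free lp w] that by blast
      have off_u: "a = b" if "a \<in> ?N" "b \<in> ?N" "a \<noteq> u" "b \<noteq> u" for a b
        using attachments_off_end[OF free longest_path_rev[OF lp], of w] that w
        by (simp add: attachments_rev)
      \<comment> \<open>One of \<open>x\<close> and \<open>y\<close> is \<open>v\<close> by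
        \<open>off_v\<close>, the other is \<open>u\<close> by \<open>off_u\<close>; a third element
        would contradict either.\<close>
      have Nuv: "?N = {u, v}"
        using x y neq off_u off_v by blast
      \<comment> \<open>The cut needs a path vertex that survives. If there is none, then
        \<open>p = [u, v]\<close>, and \<open>u\<close>, \<open>v\<close> are consecutive
        attachments.\<close>
      have "\<exists>z. z \<in> set p - {u, v}"
      proof (rule ccontr)
        assume "\<not> ?thesis"
        then have "set p = {u, v}" using uv by blast
        moreover have "distinct p" using p(1) by (simp add: vpath_iff_successively)
        ultimately have "length p = 2" using neq by (metis card_2_iff distinct_card)
        then have "p = [] @ u # v # []" using p(2,3) by (auto simp: length_Suc_conv numeral_2_eq_2)
        then show False using longest_path_consecutive[of u v "[]" u v "[]" w] lp Nuv by auto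
      qed
      then show False using sep[of "{u, v}"] Nuv uv cut by auto
    qed
  qed
  then show ?thesis using p by (auto simp: hamiltonian_path_def)
qed

theorem theorem8:
  fixes G :: "('a, 'b) pre_digraph" and u v :: 'a
  assumes "graph G"
    and "connected G"
    and "three_K1_free G"
    and "u \<in> verts G" and "v \<in> verts G" and "u \<noteq> v"
  shows "(\<exists>p. hamiltonian_path G p \<and> {hd p, last p} = {u, v}) \<longleftrightarrow>
      (\<not> articulation_point G u \<and> \<not> articulation_point G v) \<and>
      (\<forall>x\<in>verts G. articulation_point G x \<longrightarrow> in_different_components (delete_verts G {x}) u v) \<and>
      \<not> vertex_cut G {u, v}"
    (is "?L \<longleftrightarrow> ?R")
proof
  interpret graph G by fact
  assume ?L
  then obtain p where p: "hamiltonian_path G p" "{hd p, last p} = {u, v}" by blast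
  then have "p \<noteq> []" by (simp add: hamiltonian_path_def vpath_iff_successively)
  \<comment> \<open>The ends are given as an unordered pair, so \<open>p\<close> may have to be
    reversed.\<close>
  with p have "\<exists>q. hamiltonian_path G q \<and> hd q = u \<and> last q = v"
    by (auto simp: doubleton_eq_iff hamiltonian_path_def hd_rev last_rev vpath_rev_iff
        intro: exI[of _ p] exI[of _ "rev p"])
  then obtain q where "hamiltonian_path G q" "hd q = u" "last q = v" by blast
  from hamiltonian_path_imp[OF this \<open>u \<noteq> v\<close>] show ?R by blast
next
  interpret graph G by fact
  assume R: ?R
  \<comment> \<open>An articulation point is a vertex, since \<open>vertex_cut\<close> demands
    \<open>{x} \<subset> verts G\<close>.\<close>
  then have art: "in_different_components (delete_verts G {x}) u v" if "articulation_point G x" for x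
    using that by (auto simp: articulation_point_def vertex_cut_def)
  have "u \<rightarrow>\<^sup>*\<^bsub>G\<^esub> v"
    using assms(2,4,5) by (auto simp: connected_iff_strongly_connected strongly_connected_def)
  then obtain p where p: "longest_path G u v p" by (rule longest_path_exists)
  then have "hamiltonian_path G p"
    using longest_path_hamiltonian assms(2,3,6) R art by blast
  then show ?L using p by (auto simp: longest_path_def)
qed

end
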